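(* Let $V$ be a Hilbert space with a localizing space decomposition with local spaces $V_1,\dots,V_N$ and mappings $\mathcal{P}_{V_i}:V\to V_i$. Suppose that $\{1,\dots,N\}=\dot\bigcup_{k=1}^{\bar J}\Upsilon_{C,k}$ is a partition into $\bar J$ classes such that $V_i\perp V_j$ whenever $i\neq j$ belong to the same class. Let $\widetilde V\subseteq V$ be a subspace, let $P_{\widetilde V\cap V_i}$ denote the orthogonal projection onto $\widetilde V\cap V_i$, and define $$c_{\mathrm{pu},\widetilde V}:=\sup_{\varphi\in V\setminus\{0\}}\frac{\Big(\sum_{i=1}^N\|(1-P_{\widetilde V\cap V_i})\mathcal{P}_{V_i}(\varphi)\|^2\Big)^{1/2}}{\|\varphi\|} .$$ Then for every continuous linear functional $F$ on $V$ with $F(\varphi)=0$ for all $\varphi\in\widetilde V$, $$\|F\|_{V'}\le c_{\mathrm{pu},\widetilde V}\Big(\sum_{i=1}^N\|F\|_{V_i'}^2\Big)^{1/2}\le c_{\mathrm{pu},\widetilde V}\sqrt{\bar J}\,\|F\|_{V'} .$$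
   Context: A localizing space decomposition consists of: an open, bounded, connected domain $\Omega\subset\mathbb{R}^d$ with smooth boundary; a Hilbert space $V$ of functions on $\Omega$ (over $\mathbb{R}$ or $\mathbb{C}$; continuous or discrete); subdomains $\omega_1,\dots,\omega_N$ forming an overlapping or non-overlapping domain decomposition of $\Omega$; subspaces $V_1,\dots,V_N\subseteq V$ with $\sum_i V_i=V$ and $\operatorname{supp}\varphi\subseteq\omega_i$ for all $\varphi\in V_i$; and linear maps $\mathcal{P}_{V_i}:V\to V_i$ with $\sum_{i=1}^N\mathcal{P}_{V_i}(\varphi)=\varphi$ for all $\varphi\in V$. Each $V_i$ carries the norm of $V$; for a subspace $W\subseteq V$, $\|F\|_{W'}:=\sup_{\varphi\in W\setminus\{0\}}|F(\varphi)|/\|\varphi\|$. Conventions: subspaces onto which orthogonal projections are taken are understood to be closed; constants defined as suprema may take the value $+\infty$, with $0\cdot\infty=0$. *)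

theory Defs
  imports "HOL-Analysis.Analysis"
begin

text \<open>The scalar field, real or complex. The axioms force \<open>sconj\<close> to be the identity on the reals
  and complex conjugation on the complex numbers.\<close>

class scalar_field = real_normed_field +
  fixes sconj :: "'a \<Rightarrow> 'a"
  assumes sconj_add: "sconj (a + b) = sconj a + sconj b"
    and sconj_mult: "sconj (a * b) = sconj a * sconj b"
    and mult_sconj: "a * sconj a = (norm a)\<^sup>2 *\<^sub>R 1"

instantiation real :: scalar_field
begin
definition sconj_real :: "real \<Rightarrow> real" where "sconj_real a = a"
instance by standard (simp_all add: sconj_real_def power2_eq_square)
end

instantiation complex :: scalar_field
begin
definition sconj_complex :: "complex \<Rightarrow> complex" where "sconj_complex a = cnj a"
instance by standard (simp_all add: sconj_complex_def complex_mult_cnj cmod_def complex_eq_iff)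
end

text \<open>A Hilbert space over \<open>'k\<close> is a Banach space with a compatible scalar multiplication and an
  inner product inducing its norm. The library's \<open>real_inner\<close> covers real scalars only.\<close>

locale hilbert_space = vector_space sc
  for sc :: "'k::scalar_field \<Rightarrow> 'v::banach \<Rightarrow> 'v" +
  fixes ip :: "'v \<Rightarrow> 'v \<Rightarrow> 'k"
  assumes sc_of_real: "sc (of_real r) x = r *\<^sub>R x"
    and ip_add_left: "ip (x + y) z = ip x z + ip y z"
    and ip_scale_left: "ip (sc c x) y = c * ip x y"
    and ip_commute: "ip y x = sconj (ip x y)"
    and ip_self: "ip x x = of_real ((norm x)\<^sup>2)"

definition orthogonal_sets :: "('v \<Rightarrow> 'v \<Rightarrow> 'k::zero) \<Rightarrow> 'v set \<Rightarrow> 'v set \<Rightarrow> bool" where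
  "orthogonal_sets ip A B \<longleftrightarrow> (\<forall>x\<in>A. \<forall>y\<in>B. ip x y = 0)"

text \<open>Meaningful for closed subspaces \<open>W\<close> of a Hilbert space, where \<open>p\<close> exists and is unique.\<close>

definition orth_proj :: "('v \<Rightarrow> 'v \<Rightarrow> 'k::zero) \<Rightarrow> 'v::banach set \<Rightarrow> 'v \<Rightarrow> 'v" where
  "orth_proj ip W x = (THE p. p \<in> W \<and> (\<forall>w\<in>W. ip (x - p) w = 0))"

fun Ck_on :: "nat \<Rightarrow> 'a::euclidean_space set \<Rightarrow> ('a \<Rightarrow> real) \<Rightarrow> bool" where
  "Ck_on 0 U f \<longleftrightarrow> continuous_on U f"
| "Ck_on (Suc k) U f \<longleftrightarrow> (\<forall>x\<in>U. f differentiable (at x)) \<and>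
     (\<forall>v. Ck_on k U (\<lambda>x. frechet_derivative f (at x) v))"

text \<open>Near each boundary point, the set is a sublevel set of a smooth function without
  critical points.\<close>

definition smooth_boundary :: "'a::euclidean_space set \<Rightarrow> bool" where
  "smooth_boundary \<Omega> \<longleftrightarrow> (\<forall>x\<in>frontier \<Omega>. \<exists>U \<rho>. open U \<and> x \<in> U \<and> (\<forall>k. Ck_on k U \<rho>) \<and>
     (\<forall>y\<in>U. frechet_derivative \<rho> (at y) \<noteq> (\<lambda>v. 0)) \<and> \<Omega> \<inter> U = {y\<in>U. \<rho> y < 0})"

text \<open>The support relative to the space of \<open>M\<close>: the complement of the largest relatively open set
  on which \<open>f\<close> vanishes almost everywhere. For a counting measure this is the relative closure of
  the set where \<open>f\<close> is nonzero.\<close>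

definition ess_support :: "'a::euclidean_space measure \<Rightarrow> ('a \<Rightarrow> 'k::zero) \<Rightarrow> 'a set" where
  "ess_support M f = space M - \<Union>{U. open U \<and> (AE x in M. x \<in> U \<longrightarrow> f x = 0)}"

text \<open>A subdomain may be open or contain part of its boundary, so that functions which do not
  vanish on the interfaces of a non-overlapping decomposition can be supported in it.\<close>

definition subdomain :: "'a::euclidean_space set \<Rightarrow> 'a set \<Rightarrow> bool" where
  "subdomain \<Omega> \<omega> \<longleftrightarrow> \<omega> \<subseteq> \<Omega> \<and> \<omega> \<subseteq> closure (interior \<omega>)"

definition overlapping_decomposition ::
    "'a::euclidean_space set \<Rightarrow> nat \<Rightarrow> (nat \<Rightarrow> 'a set) \<Rightarrow> bool" where
  "overlapping_decomposition \<Omega> N \<omega> \<longleftrightarrow>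
     (\<forall>i\<in>{1..N}. subdomain \<Omega> (\<omega> i)) \<and> (\<Union>i\<in>{1..N}. \<omega> i) = \<Omega>"

definition nonoverlapping_decomposition ::
    "'a::euclidean_space set \<Rightarrow> nat \<Rightarrow> (nat \<Rightarrow> 'a set) \<Rightarrow> bool" where
  "nonoverlapping_decomposition \<Omega> N \<omega> \<longleftrightarrow>
     (\<forall>i\<in>{1..N}. subdomain \<Omega> (\<omega> i)) \<and>
     disjoint_family_on (\<lambda>i. interior (\<omega> i)) {1..N} \<and>
     (\<Union>i\<in>{1..N}. closure (\<omega> i)) = closure \<Omega>"

text \<open>The Hilbert space \<open>V\<close> of functions on \<open>\<Omega>\<close> is the type \<open>'v\<close>; \<open>fn \<phi>\<close> is (a representative of)
  the function \<open>\<phi>\<close>, and functions are identified if they agree almost everywhere with respect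
  to \<open>M\<close>. Lebesgue measure on \<open>\<Omega>\<close> gives spaces such as Sobolev spaces, counting measure on \<open>\<Omega>\<close>
  gives spaces of genuine functions, and a measure concentrated on a grid gives spaces of grid
  functions. The maps \<open>P i\<close> need not be continuous.\<close>

locale localizing_space_decomposition = hilbert_space sc ip
  for sc :: "'k::scalar_field \<Rightarrow> 'v::banach \<Rightarrow> 'v" and ip :: "'v \<Rightarrow> 'v \<Rightarrow> 'k" +
  fixes \<Omega> :: "(real ^ 'd) set"
    and M :: "(real ^ 'd) measure"
    and fn :: "'v \<Rightarrow> real ^ 'd \<Rightarrow> 'k"
    and N :: nat
    and \<omega> :: "nat \<Rightarrow> (real ^ 'd) set"
    and V :: "nat \<Rightarrow> 'v set"
    and P :: "nat \<Rightarrow> 'v \<Rightarrow> 'v"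
  assumes domain_open: "open \<Omega>"
    and domain_bounded: "bounded \<Omega>"
    and domain_connected: "connected \<Omega>"
    and domain_smooth: "smooth_boundary \<Omega>"
    and space_M: "space M = \<Omega>"
    and sets_M: "sets (restrict_space borel \<Omega>) \<subseteq> sets M"
    and fn_add: "AE x in M. fn (\<phi> + \<psi>) x = fn \<phi> x + fn \<psi> x"
    and fn_scale: "AE x in M. fn (sc c \<phi>) x = c * fn \<phi> x"
    and fn_inj: "(AE x in M. fn \<phi> x = fn \<psi> x) \<Longrightarrow> \<phi> = \<psi>"
    and decomposition:
      "overlapping_decomposition \<Omega> N \<omega> \<or> nonoverlapping_decomposition \<Omega> N \<omega>"
    and V_subspace: "i \<in> {1..N} \<Longrightarrow> module.subspace sc (V i)"
    and V_sum: "\<exists>f. (\<forall>i\<in>{1..N}. f i \<in> V i) \<and> \<phi> = (\<Sum>i=1..N. f i)"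
    and V_support: "i \<in> {1..N} \<Longrightarrow> \<phi> \<in> V i \<Longrightarrow> ess_support M (fn \<phi>) \<subseteq> \<omega> i"
    and P_linear: "i \<in> {1..N} \<Longrightarrow> Vector_Spaces.linear sc sc (P i)"
    and P_in: "i \<in> {1..N} \<Longrightarrow> P i \<phi> \<in> V i"
    and P_sum: "(\<Sum>i=1..N. P i \<phi>) = \<phi>"

text \<open>Suprema are taken in \<open>ennreal\<close>: they may be infinite, the supremum over the empty set is 0,
  and \<open>0 * \<infinity> = 0\<close>.\<close>

definition dual_norm :: "('v \<Rightarrow> 'k::real_normed_field) \<Rightarrow> 'v::real_normed_vector set \<Rightarrow> ennreal" where
  "dual_norm F W = (SUP \<phi>\<in>W - {0}. ennreal (norm (F \<phi>) / norm \<phi>))"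

definition ennsqrt :: "ennreal \<Rightarrow> ennreal" where
  "ennsqrt a = (if a = \<infinity> then \<infinity> else ennreal (sqrt (enn2real a)))"

definition c_pu :: "('v \<Rightarrow> 'v \<Rightarrow> 'k::zero) \<Rightarrow> nat \<Rightarrow> (nat \<Rightarrow> 'v set) \<Rightarrow> (nat \<Rightarrow> 'v \<Rightarrow> 'v) \<Rightarrow>
    'v::banach set \<Rightarrow> ennreal" where
  "c_pu ip N V P W = (SUP \<phi>\<in>UNIV - {0}. ennreal
     (sqrt (\<Sum>i=1..N. (norm (P i \<phi> - orth_proj ip (W \<inter> V i) (P i \<phi>)))\<^sup>2) / norm \<phi>))"

end

theory Submission
  imports Defs
begin

text \<open>
  The first inequality splits \<open>F \<phi>\<close> along the decomposition \<open>\<phi> = (\<Sum>i. P i \<phi>)\<close>. As \<open>F\<close> vanishes on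
  \<open>Vt\<close>, each \<open>P i \<phi>\<close> may be replaced by \<open>P i \<phi> - Q i\<close>, where \<open>Q i\<close> is its orthogonal projection
  onto \<open>Vt \<inter> V i\<close>. This difference still lies in \<open>V i\<close>, so
  \<open>norm (F \<phi>) \<le> (\<Sum>i. dual_norm F (V i) * norm (P i \<phi> - Q i))\<close>, and the Cauchy--Schwarz inequality
  in \<open>\<real>\<^sup>N\<close> turns this into the product of the two factors in the claim. The projections exist by
  the projection theorem (\<open>orth_proj_in\<close>), proved over the abstract scalar field.

  For the second inequality it suffices that \<open>(\<Sum>i\<in>I. (dual_norm F (V i))\<^sup>2) \<le> (dual_norm F UNIV)\<^sup>2\<close>
  for a set \<open>I\<close> of indices with pairwise orthogonal \<open>V i\<close> (\<open>sum_dual_norm_orthogonal_le\<close>), since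
  one can then add up over the \<open>J\<close> classes. Given \<open>u i \<in> V i\<close> of norm at most 1, put
  \<open>\<psi> = (\<Sum>i\<in>I. sc (sconj (F (u i))) (u i))\<close> and \<open>S = (\<Sum>i\<in>I. (norm (F (u i)))\<^sup>2)\<close>. Then \<open>F \<psi> = S\<close>,
  while \<open>norm \<psi> \<le> sqrt S\<close> by the Pythagorean theorem, so \<open>sqrt S\<close> is at most the norm of \<open>F\<close>.
  Letting \<open>F (u i)\<close> approach the dual norm of \<open>F\<close> on \<open>V i\<close> gives the bound.
\<close>

section \<open>Hilbert spaces over the scalar field\<close>

lemma sconj_0 [simp]: "sconj (0::'k::scalar_field) = 0"
  using sconj_add[of "0::'k" 0] by simp

lemma norm_sconj [simp]: "norm (sconj (a::'k::scalar_field)) = norm a"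
proof (cases "a = 0")
  case False
  have "norm a * norm (sconj a) = norm a * norm a"
    by (metis abs_of_nonneg mult_sconj norm_mult norm_one norm_scaleR mult_1_right
        power2_eq_square zero_le_power2)
  with False show ?thesis by simp
qed simp

context hilbert_space
begin

lemma ip_zero_left [simp]: "ip 0 z = 0"
  using ip_add_left[of 0 0 z] by simp

lemma ip_diff_left: "ip (x - y) z = ip x z - ip y z"
  using ip_add_left[of "x - y" y z] by (simp add: algebra_simps)

lemma ip_add_right: "ip x (y + z) = ip x y + ip x z"
  by (metis ip_add_left ip_commute sconj_add)

lemma ip_scale_right: "ip x (sc c y) = sconj c * ip x y"
  by (metis ip_commute ip_scale_left sconj_mult)

lemma ip_diff_right: "ip x (y - z) = ip x y - ip x z"
  using ip_add_right[of x "y - z" z] by (simp add: algebra_simps)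

lemma ip_eq_0_commute: "ip x y = 0 \<Longrightarrow> ip y x = 0"
  using ip_commute[of y x] by simp

lemma norm_sc [simp]: "norm (sc c x) = norm c * norm x"
proof -
  have "of_real ((norm (sc c x))\<^sup>2) = (c * sconj c) * ip x x"
    by (simp only: ip_self[symmetric] ip_scale_left ip_scale_right ac_simps)
  also have "\<dots> = (of_real ((norm c * norm x)\<^sup>2) :: 'k)"
    by (simp add: mult_sconj ip_self scaleR_conv_of_real power_mult_distrib)
  finally have "(norm (sc c x))\<^sup>2 = (norm c * norm x)\<^sup>2"
    by (simp only: of_real_eq_iff)
  then show ?thesis by simp
qed

lemma norm_add_Pythagorean:
  assumes "ip x y = 0"
  shows "(norm (x + y))\<^sup>2 = (norm x)\<^sup>2 + (norm y)\<^sup>2"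
proof -
  have "of_real ((norm (x + y))\<^sup>2) = ip x x + ip y y"
    using assms ip_eq_0_commute[OF assms]
    by (simp only: ip_self[symmetric] ip_add_left ip_add_right) simp
  also have "\<dots> = (of_real ((norm x)\<^sup>2 + (norm y)\<^sup>2) :: 'k)"
    by (simp only: ip_self of_real_add)
  finally show ?thesis by (simp only: of_real_eq_iff)
qed

lemma parallelogram:
  fixes x y :: 'v
  shows "(norm (x + y))\<^sup>2 + (norm (x - y))\<^sup>2 = 2 * (norm x)\<^sup>2 + 2 * (norm y)\<^sup>2"
proof -
  have "of_real ((norm (x + y))\<^sup>2 + (norm (x - y))\<^sup>2) = ip x x + ip x x + (ip y y + ip y y)"
    by (simp only: of_real_add ip_self[symmetric] ip_add_left ip_add_right ip_diff_left
        ip_diff_right) (simp add: algebra_simps)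
  also have "\<dots> = (of_real (2 * (norm x)\<^sup>2 + 2 * (norm y)\<^sup>2) :: 'k)"
    by (simp only: ip_self of_real_add[symmetric]) simp
  finally show ?thesis by (simp only: of_real_eq_iff)
qed

lemma ip_sum_left: "ip (\<Sum>i\<in>I. f i) z = (\<Sum>i\<in>I. ip (f i) z)"
  by (induction I rule: infinite_finite_induct) (auto simp: ip_add_left)

lemma norm_sum_Pythagorean:
  assumes "finite I" and "\<And>i j. i \<in> I \<Longrightarrow> j \<in> I \<Longrightarrow> i \<noteq> j \<Longrightarrow> ip (f i) (f j) = 0"
  shows "(norm (\<Sum>i\<in>I. f i))\<^sup>2 = (\<Sum>i\<in>I. (norm (f i))\<^sup>2)"
  using assms
proof (induction I rule: finite_induct)
  case (insert a I)
  have "ip (\<Sum>i\<in>I. f i) (f a) = 0"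
    using insert.hyps insert.prems by (auto simp: ip_sum_left intro!: sum.neutral)
  then have "ip (f a) (\<Sum>i\<in>I. f i) = 0"
    by (rule ip_eq_0_commute)
  then show ?case
    using insert by (simp add: norm_add_Pythagorean)
qed simp

section \<open>Orthogonal projections\<close>

lemma nearest_point_exists:
  assumes W: "subspace W" and "closed W"
  shows "\<exists>p\<in>W. \<forall>w\<in>W. norm (x - p) \<le> norm (x - w)"
proof -
  have W0: "W \<noteq> {}" using subspace_0[OF W] by blast
  define d where "d = infdist x W"
  have d0: "0 \<le> d" by (simp add: d_def infdist_nonneg)
  have d_le: "d \<le> norm (x - w)" if "w \<in> W" for w
    using infdist_le[OF that, of x] by (simp add: d_def dist_norm)
  have "\<exists>w\<in>W. norm (x - w) < d + 1 / real (Suc n)" for n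
  proof -
    have "infdist x W < d + 1 / real (Suc n)" by (simp add: d_def)
    then obtain w where "w \<in> W" "dist x w < d + 1 / real (Suc n)"
      using W0 by (auto simp: infdist_notempty cINF_less_iff)
    then show ?thesis by (auto simp: dist_norm)
  qed
  then obtain w where wW: "\<And>n. w n \<in> W" and wd: "\<And>n. norm (x - w n) < d + 1 / real (Suc n)"
    by metis
  have wlim: "(\<lambda>n. norm (x - w n)) \<longlonglongrightarrow> d"
  proof (rule tendsto_sandwich)
    show "\<forall>\<^sub>F n in sequentially. d \<le> norm (x - w n)"
      using d_le[OF wW] by simp
    show "\<forall>\<^sub>F n in sequentially. norm (x - w n) \<le> d + 1 / real (Suc n)"
      using wd by (intro always_eventually allI less_imp_le)
    show "(\<lambda>n. d + 1 / real (Suc n)) \<longlonglongrightarrow> d"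
      using tendsto_add[OF tendsto_const[of d] LIMSEQ_inverse_real_of_nat]
      by (simp only: inverse_eq_divide add_0_right)
  qed (rule tendsto_const)
  \<comment> \<open>The midpoint of two points of \<open>W\<close> is in \<open>W\<close>, hence at distance at least \<open>d\<close> from \<open>x\<close>.\<close>
  have cauchy_bound:
    "(norm (w m - w n))\<^sup>2 \<le> 2 * (norm (x - w m))\<^sup>2 + 2 * (norm (x - w n))\<^sup>2 - 4 * d\<^sup>2" for m n
  proof -
    let ?mid = "(1/2) *\<^sub>R (w m + w n)"
    have "?mid \<in> W"
      using subspace_scale[OF W subspace_add[OF W wW wW], of "of_real (1/2)" m n]
      by (simp only: sc_of_real)
    then have "d \<le> norm (x - ?mid)" by (rule d_le)
    moreover have "(x - w m) + (x - w n) = 2 *\<^sub>R (x - ?mid)"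
      by (simp add: algebra_simps scaleR_2)
    ultimately have "2 * d \<le> norm ((x - w m) + (x - w n))" by simp
    then have "4 * d\<^sup>2 \<le> (norm ((x - w m) + (x - w n)))\<^sup>2"
      using power_mono[of "2 * d" _ 2] d0 by (simp add: power_mult_distrib)
    with parallelogram[of "x - w m" "x - w n"] show ?thesis
      by (simp add: norm_minus_commute)
  qed
  have "Cauchy w"
  proof (rule metric_CauchyI)
    fix e :: real
    assume e: "0 < e"
    have "(\<lambda>n. (norm (x - w n))\<^sup>2) \<longlonglongrightarrow> d\<^sup>2"
      by (intro tendsto_power wlim)
    moreover have "d\<^sup>2 < d\<^sup>2 + e\<^sup>2 / 4" using e by simp
    ultimately have "\<forall>\<^sub>F n in sequentially. (norm (x - w n))\<^sup>2 < d\<^sup>2 + e\<^sup>2 / 4"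
      by (rule order_tendstoD)
    then obtain M where M: "\<And>n. n \<ge> M \<Longrightarrow> (norm (x - w n))\<^sup>2 < d\<^sup>2 + e\<^sup>2 / 4"
      by (auto simp: eventually_sequentially)
    have "dist (w m) (w n) < e" if "m \<ge> M" "n \<ge> M" for m n
    proof -
      have "(norm (w m - w n))\<^sup>2 < e\<^sup>2"
        using cauchy_bound[of m n] M[OF that(1)] M[OF that(2)] by simp
      then show ?thesis
        using e by (simp add: dist_norm power_less_imp_less_base)
    qed
    then show "\<exists>M. \<forall>m\<ge>M. \<forall>n\<ge>M. dist (w m) (w n) < e" by blast
  qed
  then obtain p where p: "w \<longlonglongrightarrow> p"
    using Cauchy_convergent convergent_def by blast
  have "p \<in> W"
    using \<open>closed W\<close> wW p by (meson closed_sequentially)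
  moreover have "norm (x - p) = d"
    by (rule LIMSEQ_unique[OF tendsto_norm[OF tendsto_diff[OF tendsto_const p]] wlim])
  ultimately show ?thesis using d_le by metis
qed

text \<open>If subtracting multiples of \<open>w\<close> never makes \<open>r\<close> shorter, then \<open>r\<close> is orthogonal to \<open>w\<close>.\<close>

lemma ip_eq_0_if_nearest:
  assumes "\<And>c. norm r \<le> norm (r - sc c w)"
  shows "ip r w = 0"
proof (cases "w = 0")
  case True
  then show ?thesis using ip_eq_0_commute[OF ip_zero_left] by simp
next
  case False
  \<comment> \<open>\<open>sc c w\<close> is the component of \<open>r\<close> along \<open>w\<close>; removing it leaves a vector orthogonal to \<open>w\<close>.\<close>
  define c where "c = ip r w / ip w w"
  have "ip w w \<noteq> 0" using False by (simp add: ip_self)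
  then have orth: "ip (r - sc c w) w = 0"
    by (simp add: c_def ip_diff_left ip_scale_left)
  then have "(norm ((r - sc c w) + sc c w))\<^sup>2 = (norm (r - sc c w))\<^sup>2 + (norm (sc c w))\<^sup>2"
    by (intro norm_add_Pythagorean) (simp add: ip_scale_right)
  moreover have "(norm r)\<^sup>2 \<le> (norm (r - sc c w))\<^sup>2"
    using assms by (simp add: power_mono)
  ultimately have "(norm (sc c w))\<^sup>2 \<le> 0" by simp
  then have "sc c w = 0" by (metis norm_le_zero_iff power2_less_eq_zero_iff norm_eq_zero)
  with orth show ?thesis by simp
qed

theorem orth_proj_ex1:
  assumes W: "subspace W" and "closed W"
  shows "\<exists>!p. p \<in> W \<and> (\<forall>w\<in>W. ip (x - p) w = 0)"
proof (rule ex_ex1I)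
  obtain p where p: "p \<in> W" and near: "\<And>w. w \<in> W \<Longrightarrow> norm (x - p) \<le> norm (x - w)"
    using nearest_point_exists[OF assms] by blast
  have "ip (x - p) w = 0" if "w \<in> W" for w
  proof (rule ip_eq_0_if_nearest)
    fix c
    have "p + sc c w \<in> W" using W p that by (simp add: subspace_add subspace_scale)
    from near[OF this] show "norm (x - p) \<le> norm (x - p - sc c w)"
      by (simp add: diff_diff_eq)
  qed
  with p show "\<exists>p. p \<in> W \<and> (\<forall>w\<in>W. ip (x - p) w = 0)" by blast
next
  fix p q
  assume pq: "p \<in> W \<and> (\<forall>w\<in>W. ip (x - p) w = 0)" "q \<in> W \<and> (\<forall>w\<in>W. ip (x - q) w = 0)"
  then have "p - q \<in> W" using W by (simp add: subspace_diff)
  with pq have "ip (x - q) (p - q) - ip (x - p) (p - q) = 0" by simp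
  then have "ip (p - q) (p - q) = 0" by (simp add: ip_diff_left)
  then show "p = q" by (simp add: ip_self)
qed

lemma orth_proj_in:
  assumes "subspace W" and "closed W"
  shows "orth_proj ip W x \<in> W"
  using theI'[OF orth_proj_ex1[OF assms, of x]] by (simp add: orth_proj_def)

section \<open>Continuous functionals and their dual norms\<close>

lemma continuous_functional_bounded_linear:
  assumes lin: "Vector_Spaces.linear sc (*) F" and "continuous_on UNIV F"
  shows "bounded_linear F"
proof -
  have add: "F (x + y) = F x + F y" and scale: "F (sc c x) = c * F x" for x y c
    using lin by (simp_all add: Vector_Spaces.linear_iff)
  have scaleR: "F (r *\<^sub>R x) = r *\<^sub>R F x" for r x
    using scale[of "of_real r" x] by (simp add: sc_of_real scaleR_conv_of_real)
  have "linear F" using add scaleR by (rule linearI)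
  then have F0: "F 0 = 0" by (rule linear_0)
  have "isCont F 0" using assms(2) by (simp add: continuous_on_eq_continuous_at)
  then obtain s where s: "s > 0" and small: "\<And>x. dist x 0 < s \<Longrightarrow> dist (F x) (F 0) < 1"
    unfolding continuous_at_eps_delta by (metis zero_less_one)
  show ?thesis
  proof (rule bounded_linear_intro[OF add scaleR])
    fix x
    show "norm (F x) \<le> norm x * (2 / s)"
    proof (cases "x = 0")
      case False
      \<comment> \<open>This factor scales \<open>x\<close> to norm \<open>s / 2\<close>, where \<open>F\<close> is small.\<close>
      let ?t = "s / (2 * norm x)"
      have t: "?t > 0" using s False by simp
      have "norm (?t *\<^sub>R x) = s / 2"
        using s False by simp
      then have "norm (F (?t *\<^sub>R x)) < 1"
        using small[of "?t *\<^sub>R x"] s F0 by simp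
      then have "?t * norm (F x) < 1" using t s by (simp add: scaleR)
      then show ?thesis using s False by (simp add: field_simps)
    qed (simp add: F0)
  qed
qed

end

lemma dual_norm_le:
  fixes F :: "'v::real_normed_vector \<Rightarrow> 'k::real_normed_field"
  assumes "\<And>x. x \<in> W \<Longrightarrow> norm (F x) \<le> K * norm x"
  shows "dual_norm F W \<le> ennreal K"
  unfolding dual_norm_def
proof (intro SUP_least ennreal_leI)
  fix x assume "x \<in> W - {0}"
  then show "norm (F x) / norm x \<le> K"
    using assms[of x] by (simp add: pos_divide_le_eq)
qed

lemma dual_norm_finite:
  assumes "bounded_linear F"
  shows "dual_norm F W < \<infinity>"
proof -
  obtain K where "\<And>x. norm (F x) \<le> norm x * K"
    using bounded_linear.bounded[OF assms] by blast
  then have "dual_norm F W \<le> ennreal K"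
    by (intro dual_norm_le) (simp add: mult.commute)
  also have "\<dots> < \<infinity>" by simp
  finally show ?thesis .
qed

lemma norm_le_dual_norm:
  assumes F: "bounded_linear F" and x: "x \<in> W"
  shows "norm (F x) \<le> enn2real (dual_norm F W) * norm x"
proof (cases "x = 0")
  case True
  then show ?thesis using linear_0[OF bounded_linear.linear[OF F]] by simp
next
  case False
  have "ennreal (norm (F x) / norm x) \<le> dual_norm F W"
    unfolding dual_norm_def using x False by (intro SUP_upper) auto
  then have "norm (F x) / norm x \<le> enn2real (dual_norm F W)"
    using enn2real_mono dual_norm_finite[OF F, of W] by fastforce
  then show ?thesis using False by (simp add: divide_le_eq)
qed

text \<open>The supremum is attained up to a factor \<open>t < 1\<close>. Vectors of norm at most 1, rather than
  equal to 1, cover the case \<open>W = {0}\<close>.\<close>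

lemma dual_norm_almost_attained:
  fixes F :: "'v::real_normed_vector \<Rightarrow> 'k::real_normed_field"
  assumes F: "bounded_linear F" and "0 \<in> W" and t: "0 < t" "t < 1"
    and scaled: "\<And>r x. x \<in> W \<Longrightarrow> r *\<^sub>R x \<in> W"
  shows "\<exists>u\<in>W. norm u \<le> 1 \<and> t * enn2real (dual_norm F W) \<le> norm (F u)"
proof (cases "dual_norm F W = 0")
  case True
  then show ?thesis using \<open>0 \<in> W\<close> by (intro bexI[of _ 0]) auto
next
  case False
  define a where "a = enn2real (dual_norm F W)"
  have a: "dual_norm F W = ennreal a"
    using dual_norm_finite[OF F, of W] by (simp add: a_def)
  with False have "a > 0" by (metis a_def enn2real_nonneg ennreal_0 less_eq_real_def)
  then have "ennreal (t * a) < dual_norm F W"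
    using t by (simp add: a ennreal_less_iff)
  then obtain x where x: "x \<in> W" "x \<noteq> 0" and "ennreal (t * a) < ennreal (norm (F x) / norm x)"
    unfolding dual_norm_def less_SUP_iff by auto
  then have "t * a < norm (F x) / norm x"
    using \<open>a > 0\<close> t by (simp add: ennreal_less_iff)
  moreover have "norm (F ((1 / norm x) *\<^sub>R x)) = norm (F x) / norm x"
    using linear_scale[OF bounded_linear.linear[OF F]] by simp
  ultimately show ?thesis
    using x scaled[of x "1 / norm x"] by (intro bexI[of _ "(1 / norm x) *\<^sub>R x"]) (auto simp: a_def)
qed

context hilbert_space
begin

text \<open>The vector \<open>\<Sum>i\<in>I. sc (sconj (F (u i))) (u i)\<close> tests \<open>F\<close> on all the \<open>V i\<close> at once: the conjugate
  coefficients make \<open>F\<close> of it the sum of the squares \<open>(norm (F (u i)))\<^sup>2\<close>.\<close>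

lemma sum_dual_norm_orthogonal_le:
  assumes lin: "Vector_Spaces.linear sc (*) F" and cont: "continuous_on UNIV F"
    and I: "finite I" and sub: "\<And>i. i \<in> I \<Longrightarrow> subspace (V i)"
    and orth: "\<And>i j. i \<in> I \<Longrightarrow> j \<in> I \<Longrightarrow> i \<noteq> j \<Longrightarrow> orthogonal_sets ip (V i) (V j)"
  shows "(\<Sum>i\<in>I. (enn2real (dual_norm F (V i)))\<^sup>2) \<le> (enn2real (dual_norm F UNIV))\<^sup>2"
proof (rule field_le_mult_one_interval)
  fix z :: real
  assume z: "0 < z" "z < 1"
  define a where "a i = enn2real (dual_norm F (V i))" for i
  define B where "B = enn2real (dual_norm F UNIV)"
  have F: "bounded_linear F"
    using lin cont by (rule continuous_functional_bounded_linear)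
  have "\<exists>u\<in>V i. norm u \<le> 1 \<and> sqrt z * a i \<le> norm (F u)" if "i \<in> I" for i
    unfolding a_def
  proof (rule dual_norm_almost_attained[OF F])
    show "r *\<^sub>R x \<in> V i" if "x \<in> V i" for r x
      using subspace_scale[OF sub[OF \<open>i \<in> I\<close>] that, of "of_real r"] by (simp only: sc_of_real)
  qed (use z subspace_0[OF sub[OF that]] in auto)
  then obtain u where uV: "\<And>i. i \<in> I \<Longrightarrow> u i \<in> V i" and u1: "\<And>i. i \<in> I \<Longrightarrow> norm (u i) \<le> 1"
    and ua: "\<And>i. i \<in> I \<Longrightarrow> sqrt z * a i \<le> norm (F (u i))"
    by metis
  define f where "f i = sc (sconj (F (u i))) (u i)" for i
  define S where "S = (\<Sum>i\<in>I. (norm (F (u i)))\<^sup>2)"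
  have S0: "0 \<le> S" by (simp add: S_def sum_nonneg)
  have Ff: "F (f i) = of_real ((norm (F (u i)))\<^sup>2)" for i
  proof -
    have "F (f i) = F (u i) * sconj (F (u i))"
      using lin by (simp add: f_def Vector_Spaces.linear_iff mult.commute)
    then show ?thesis by (simp add: mult_sconj scaleR_conv_of_real)
  qed
  have "F (\<Sum>i\<in>I. f i) = of_real S"
    by (simp only: linear_sum[OF bounded_linear.linear[OF F]] Ff S_def of_real_sum)
  then have "S \<le> B * norm (\<Sum>i\<in>I. f i)"
    using norm_le_dual_norm[OF F UNIV_I, of "\<Sum>i\<in>I. f i"] S0 by (simp add: B_def)
  moreover have "norm (\<Sum>i\<in>I. f i) \<le> sqrt S"
  proof (rule real_le_rsqrt)
    have "(norm (\<Sum>i\<in>I. f i))\<^sup>2 = (\<Sum>i\<in>I. (norm (f i))\<^sup>2)"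
      using I
    proof (rule norm_sum_Pythagorean)
      show "ip (f i) (f j) = 0" if "i \<in> I" "j \<in> I" "i \<noteq> j" for i j
        using orth[OF that] uV that
        by (simp add: f_def ip_scale_left ip_scale_right orthogonal_sets_def)
    qed
    also have "\<dots> \<le> S"
      unfolding S_def
    proof (intro sum_mono power_mono)
      show "norm (f i) \<le> norm (F (u i))" if "i \<in> I" for i
        using mult_left_mono[OF u1[OF that], of "norm (F (u i))"] by (simp add: f_def)
    qed simp
    finally show "(norm (\<Sum>i\<in>I. f i))\<^sup>2 \<le> S" .
  qed
  ultimately have "S \<le> B * sqrt S"
    by (metis B_def enn2real_nonneg mult_left_mono order_trans)
  then have "sqrt S * sqrt S \<le> B * sqrt S" using S0 by simp
  have "sqrt S \<le> B"
  proof (cases "S = 0")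
    case False
    with S0 have "0 < sqrt S" by simp
    with \<open>sqrt S * sqrt S \<le> B * sqrt S\<close> show ?thesis by (rule mult_right_le_imp_le)
  qed (simp add: B_def)
  then have "S \<le> B\<^sup>2" by (rule sqrt_le_D)
  moreover have "z * (\<Sum>i\<in>I. (a i)\<^sup>2) \<le> S"
    unfolding S_def sum_distrib_left
  proof (rule sum_mono)
    fix i assume "i \<in> I"
    from power_mono[OF ua[OF this], of 2] show "z * (a i)\<^sup>2 \<le> (norm (F (u i)))\<^sup>2"
      using z by (simp add: power_mult_distrib a_def)
  qed
  ultimately show "z * (\<Sum>i\<in>I. (enn2real (dual_norm F (V i)))\<^sup>2) \<le> (enn2real (dual_norm F UNIV))\<^sup>2"
    by (simp add: a_def B_def)
qed

end

lemma ennsqrt_sum_dual_norm: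
  assumes "bounded_linear F"
  shows "ennsqrt (\<Sum>i\<in>I. (dual_norm F (V i))\<^sup>2)
    = ennreal (sqrt (\<Sum>i\<in>I. (enn2real (dual_norm F (V i)))\<^sup>2))"
proof -
  have "(dual_norm F (V i))\<^sup>2 = ennreal ((enn2real (dual_norm F (V i)))\<^sup>2)" for i
    using dual_norm_finite[OF assms, of "V i"] by (simp add: ennreal_power[symmetric])
  then have "(\<Sum>i\<in>I. (dual_norm F (V i))\<^sup>2) = ennreal (\<Sum>i\<in>I. (enn2real (dual_norm F (V i)))\<^sup>2)"
    by (simp add: sum_ennreal)
  then show ?thesis by (simp add: ennsqrt_def sum_nonneg)
qed

section \<open>The localization estimate\<close>

theorem proposition4p2p3:
  fixes sc :: "'k::scalar_field \<Rightarrow> 'v::banach \<Rightarrow> 'v"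
    and ip :: "'v \<Rightarrow> 'v \<Rightarrow> 'k"
    and \<Omega> :: "(real ^ 'd) set"
    and M :: "(real ^ 'd) measure"
    and fn :: "'v \<Rightarrow> real ^ 'd \<Rightarrow> 'k"
    and N J :: nat
    and \<omega> :: "nat \<Rightarrow> (real ^ 'd) set"
    and V :: "nat \<Rightarrow> 'v set"
    and P :: "nat \<Rightarrow> 'v \<Rightarrow> 'v"
    and \<Upsilon> :: "nat \<Rightarrow> nat set"
    and Vt :: "'v set"
    and F :: "'v \<Rightarrow> 'k"
  assumes "localizing_space_decomposition sc ip \<Omega> M fn N \<omega> V P"
    and "(\<Union>k\<in>{1..J}. \<Upsilon> k) = {1..N}"
    and "disjoint_family_on \<Upsilon> {1..J}"
    and "\<And>k i j. k \<in> {1..J} \<Longrightarrow> i \<in> \<Upsilon> k \<Longrightarrow> j \<in> \<Upsilon> k \<Longrightarrow> i \<noteq> j \<Longrightarrow> orthogonal_sets ip (V i) (V j)"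
    and "module.subspace sc Vt"
    and "\<And>i. i \<in> {1..N} \<Longrightarrow> closed (Vt \<inter> V i)"
    and "Vector_Spaces.linear sc (*) F"
    and "continuous_on UNIV F"
    and "\<And>\<phi>. \<phi> \<in> Vt \<Longrightarrow> F \<phi> = 0"
  shows "dual_norm F UNIV \<le> c_pu ip N V P Vt * ennsqrt (\<Sum>i=1..N. (dual_norm F (V i))\<^sup>2)
    \<and> c_pu ip N V P Vt * ennsqrt (\<Sum>i=1..N. (dual_norm F (V i))\<^sup>2)
      \<le> c_pu ip N V P Vt * ennreal (sqrt (real J)) * dual_norm F UNIV"
proof
  interpret localizing_space_decomposition sc ip \<Omega> M fn N \<omega> V P
    by (rule assms(1))
  have F: "bounded_linear F"
    using assms(7,8) by (rule continuous_functional_bounded_linear)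
  \<comment> \<open>The dual norms of \<open>F\<close> are finite, so only \<open>c_pu\<close> may take the value \<open>\<infinity>\<close>.\<close>
  define a where "a i = enn2real (dual_norm F (V i))" for i
  define B where "B = enn2real (dual_norm F UNIV)"
  have B: "dual_norm F UNIV = ennreal B"
    using dual_norm_finite[OF F, of UNIV] by (simp add: B_def)
  have S: "ennsqrt (\<Sum>i=1..N. (dual_norm F (V i))\<^sup>2) = ennreal (sqrt (\<Sum>i=1..N. (a i)\<^sup>2))"
    unfolding a_def by (rule ennsqrt_sum_dual_norm[OF F])

  show "dual_norm F UNIV \<le> c_pu ip N V P Vt * ennsqrt (\<Sum>i=1..N. (dual_norm F (V i))\<^sup>2)"
    unfolding dual_norm_def[of F UNIV] S
  \<comment> \<open>Bounding each quotient in \<open>ennreal\<close> also covers an infinite \<open>c_pu\<close>, including the case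
    \<open>\<infinity> * 0 = 0\<close>.\<close>
  proof (rule SUP_least)
    fix \<phi> :: 'v
    assume \<phi>: "\<phi> \<in> UNIV - {0}"
    define q where "q i = orth_proj ip (Vt \<inter> V i) (P i \<phi>)" for i
    define e where "e i = P i \<phi> - q i" for i
    have q: "q i \<in> Vt \<inter> V i" if "i \<in> {1..N}" for i
      unfolding q_def
      using assms(5) V_subspace[OF that] assms(6)[OF that]
      by (intro orth_proj_in subspace_inter)
    have "F (P i \<phi>) = F (e i)" if "i \<in> {1..N}" for i
      using q[OF that] assms(9) linear_diff[OF bounded_linear.linear[OF F]] by (simp add: e_def)
    then have "F \<phi> = (\<Sum>i=1..N. F (e i))"
      using linear_sum[OF bounded_linear.linear[OF F], of "\<lambda>i. P i \<phi>" "{1..N}"]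
      unfolding P_sum by simp
    then have "norm (F \<phi>) \<le> (\<Sum>i=1..N. norm (F (e i)))"
      by (simp add: norm_sum)
    also have "\<dots> \<le> (\<Sum>i=1..N. a i * norm (e i))"
    proof (rule sum_mono)
      fix i assume i: "i \<in> {1..N}"
      have "e i \<in> V i"
        unfolding e_def using q[OF i] V_subspace[OF i] P_in[OF i] by (auto intro: subspace_diff)
      then show "norm (F (e i)) \<le> a i * norm (e i)"
        unfolding a_def by (rule norm_le_dual_norm[OF F])
    qed
    also have "\<dots> \<le> sqrt (\<Sum>i=1..N. (a i)\<^sup>2) * sqrt (\<Sum>i=1..N. (norm (e i))\<^sup>2)"
      using L2_set_mult_ineq[of a "\<lambda>i. norm (e i)" "{1..N}"] by (simp add: L2_set_def a_def)
    finally have "norm (F \<phi>) / norm \<phi>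
        \<le> (sqrt (\<Sum>i=1..N. (norm (e i))\<^sup>2) / norm \<phi>) * sqrt (\<Sum>i=1..N. (a i)\<^sup>2)"
      by (simp add: divide_right_mono mult.commute)
    then have "ennreal (norm (F \<phi>) / norm \<phi>)
        \<le> ennreal (sqrt (\<Sum>i=1..N. (norm (e i))\<^sup>2) / norm \<phi>) * ennreal (sqrt (\<Sum>i=1..N. (a i)\<^sup>2))"
      by (subst ennreal_mult[symmetric]) (auto intro!: ennreal_leI sum_nonneg divide_nonneg_nonneg)
    also have "\<dots> \<le> c_pu ip N V P Vt * ennreal (sqrt (\<Sum>i=1..N. (a i)\<^sup>2))"
      unfolding c_pu_def e_def q_def using \<phi> by (intro mult_right_mono SUP_upper) auto
    finally show "ennreal (norm (F \<phi>) / norm \<phi>)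
        \<le> c_pu ip N V P Vt * ennreal (sqrt (\<Sum>i=1..N. (a i)\<^sup>2))" .
  qed

  have "(\<Sum>i=1..N. (a i)\<^sup>2) = (\<Sum>k=1..J. \<Sum>i\<in>\<Upsilon> k. (a i)\<^sup>2)"
  proof -
    have "\<forall>k\<in>{1..J}. finite (\<Upsilon> k)"
      using assms(2) by (metis UN_upper finite_atLeastAtMost finite_subset)
    then show ?thesis
      using assms(3) unfolding assms(2)[symmetric] disjoint_family_on_def
      by (intro sum.UNION_disjoint) auto
  qed
  also have "\<dots> \<le> (\<Sum>k=1..J. B\<^sup>2)"
  proof (rule sum_mono)
    fix k assume k: "k \<in> {1..J}"
    then have sub: "\<Upsilon> k \<subseteq> {1..N}" using assms(2) by blast
    show "(\<Sum>i\<in>\<Upsilon> k. (a i)\<^sup>2) \<le> B\<^sup>2"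
      unfolding a_def B_def
      using sub k assms(4) V_subspace finite_subset[OF sub]
      by (intro sum_dual_norm_orthogonal_le[OF assms(7,8)]) auto
  qed
  finally have "sqrt (\<Sum>i=1..N. (a i)\<^sup>2) \<le> sqrt (real J * B\<^sup>2)" by simp
  also have "\<dots> = sqrt (real J) * B" by (simp add: real_sqrt_mult B_def)
  finally have "ennreal (sqrt (\<Sum>i=1..N. (a i)\<^sup>2)) \<le> ennreal (sqrt (real J)) * ennreal B"
    by (subst ennreal_mult[symmetric]) (auto intro!: ennreal_leI simp: B_def)
  then show "c_pu ip N V P Vt * ennsqrt (\<Sum>i=1..N. (dual_norm F (V i))\<^sup>2)
      \<le> c_pu ip N V P Vt * ennreal (sqrt (real J)) * dual_norm F UNIV"
    unfolding S B mult.assoc by (rule mult_left_mono) simp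
qed

end
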